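(* Let $n\ge 2$ and let $G$ be the complete graph on $n-1$ vertices. The graph multiplihedron $\mathcal{J}G$ is combinatorially equivalent to the permutohedron $\mathcal{P}_n$; that is, the poset of marked tubings of $G$ is isomorphic to the face poset of $\mathcal{P}_n$.
   Context: Graphs are finite, simple, with at least one node. A tube of $G$ is a nonempty set of nodes whose induced subgraph is connected; in addition, the set of all nodes of $G$ (whether or not $G$ is connected) is considered a tube, called the universal tube. Two distinct tubes $u_1,u_2$ intersect if $u_1\cap u_2\ne\emptyset$, $u_1\not\subset u_2$ and $u_2\not\subset u_1$; they are adjacent if $u_1\cap u_2=\emptyset$ and $u_1\cup u_2$ is a tube; they are compatible if they neither intersect nor are adjacent. A tubing of $G$ is a set of pairwise compatible tubes of $G$ that contains the universal tube and, if $G$ is disconnected, does not contain all of the tubes given by the node sets of the connected components of $G$. A marked tubing of $G$ is a tubing together with an assignment to each of its tubes of exactly one of the markings thin, thick, broken, such that whenever $u\subsetneq v$ are tubes of the tubing and $v$ is not thick, then $u$ is thin. In a tubing, $u$ is closely nested in $v$, written $u\Subset v$, if $u\subsetneq v$ and no tube $u'$ of the tubing satisfies $u\subsetneq u'\subsetneq v$. Order on marked tubings: $U\preceq U'$ if $U$ is obtained from $U'$ by a finite (possibly empty) sequence of the following moves, each producing again a marked tubing: (1) a broken tube becomes thin or becomes thick; (2) a thin tube is added inside a thin tube or inside a broken tube; (3) a thick tube is added inside a thick tube; (4) a nonempty collection of compatible broken tubes $\{u_1,\dots,u_m\}$ is added simultaneously inside a broken tube $v$, with $u_i\Subset v$ for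 all $i$ in the resulting tubing, and at the same time $v$ becomes thick. The graph multiplihedron $\mathcal{J}G$ is the convex polytope, of dimension the number of nodes of $G$, whose face poset (nonempty faces, including the polytope itself, ordered by inclusion) is isomorphic to the poset of marked tubings of $G$ under $\preceq$. The permutohedron $\mathcal{P}_n$ is the $(n-1)$-dimensional polytope that is the convex hull in $\mathbb{R}^n$ of the $n!$ points obtained by permuting the coordinates of $(1,2,\dots,n)$. *)

theory Defs
  imports
    "HOL-Analysis.Analysis"
    "Graph_Theory.Graph_Theory"
begin

text \<open>
  Finite simple graphs are rendered by the locale predicate \<open>graph\<close> of the Graph\_Theory entry
  (finite, symmetric, without loops or parallel arcs).  The constant \<open>connected\<close> is qualified below
  because the topological one has the same base name.  Graph connectedness there includes
  nonemptiness.
\<close>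

section \<open>Tubes and tubings\<close>

definition universal_tube :: "('a, 'b) pre_digraph \<Rightarrow> 'a set" where
  "universal_tube G = verts G"

definition tube :: "('a, 'b) pre_digraph \<Rightarrow> 'a set \<Rightarrow> bool" where
  "tube G u \<longleftrightarrow>
     (u \<subseteq> verts G \<and> u \<noteq> {} \<and> Digraph_Component.connected (G \<restriction> u)) \<or> u = universal_tube G"

definition tubes_intersect :: "'a set \<Rightarrow> 'a set \<Rightarrow> bool" where
  "tubes_intersect u1 u2 \<longleftrightarrow> u1 \<inter> u2 \<noteq> {} \<and> \<not> u1 \<subset> u2 \<and> \<not> u2 \<subset> u1"

definition tubes_adjacent :: "('a, 'b) pre_digraph \<Rightarrow> 'a set \<Rightarrow> 'a set \<Rightarrow> bool" where
  "tubes_adjacent G u1 u2 \<longleftrightarrow> u1 \<inter> u2 = {} \<and> tube G (u1 \<union> u2)"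

text \<open>This and the two preceding relations are only meant for distinct tubes.\<close>

definition tubes_compatible :: "('a, 'b) pre_digraph \<Rightarrow> 'a set \<Rightarrow> 'a set \<Rightarrow> bool" where
  "tubes_compatible G u1 u2 \<longleftrightarrow> \<not> tubes_intersect u1 u2 \<and> \<not> tubes_adjacent G u1 u2"

definition component_tubes :: "('a, 'b) pre_digraph \<Rightarrow> 'a set set" where
  "component_tubes G = verts ` {H. pre_digraph.max_subgraph G Digraph_Component.connected H}"

definition tubing :: "('a, 'b) pre_digraph \<Rightarrow> 'a set set \<Rightarrow> bool" where
  "tubing G T \<longleftrightarrow>
     (\<forall>u\<in>T. tube G u) \<and>
     pairwise (tubes_compatible G) T \<and>
     universal_tube G \<in> T \<and>
     (\<not> Digraph_Component.connected G \<longrightarrow> \<not> component_tubes G \<subseteq> T)"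

definition closely_nested :: "'a set set \<Rightarrow> 'a set \<Rightarrow> 'a set \<Rightarrow> bool" where
  "closely_nested T u v \<longleftrightarrow>
     u \<in> T \<and> v \<in> T \<and> u \<subset> v \<and> \<not> (\<exists>u'\<in>T. u \<subset> u' \<and> u' \<subset> v)"

section \<open>Marked tubings\<close>

datatype marking = Thin | Thick | Broken

text \<open>A marked tubing is a partial map whose domain is the underlying tubing.\<close>

definition marked_tubing :: "('a, 'b) pre_digraph \<Rightarrow> ('a set \<rightharpoonup> marking) \<Rightarrow> bool" where
  "marked_tubing G m \<longleftrightarrow>
     tubing G (dom m) \<and>
     (\<forall>u\<in>dom m. \<forall>v\<in>dom m. u \<subset> v \<and> m v \<noteq> Some Thick \<longrightarrow> m u = Some Thin)"

text \<open>\<open>marking_move G m m'\<close> means that \<open>m'\<close> is obtained from \<open>m\<close> by one move.\<close>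

inductive marking_move ::
  "('a, 'b) pre_digraph \<Rightarrow> ('a set \<rightharpoonup> marking) \<Rightarrow> ('a set \<rightharpoonup> marking) \<Rightarrow> bool"
  for G :: "('a, 'b) pre_digraph"
where
  resolve_broken:
    "\<lbrakk> marked_tubing G m; m u = Some Broken; k = Thin \<or> k = Thick;
       m' = m(u \<mapsto> k); marked_tubing G m' \<rbrakk> \<Longrightarrow> marking_move G m m'"
| add_thin:
    "\<lbrakk> marked_tubing G m; m v = Some Thin \<or> m v = Some Broken; u \<notin> dom m; u \<subset> v;
       m' = m(u \<mapsto> Thin); marked_tubing G m' \<rbrakk> \<Longrightarrow> marking_move G m m'"
| add_thick:
    "\<lbrakk> marked_tubing G m; m v = Some Thick; u \<notin> dom m; u \<subset> v;
       m' = m(u \<mapsto> Thick); marked_tubing G m' \<rbrakk> \<Longrightarrow> marking_move G m m'"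
| split_broken:
    "\<lbrakk> marked_tubing G m; m v = Some Broken; C \<noteq> {}; C \<inter> dom m = {};
       pairwise (tubes_compatible G) C;
       m' = (\<lambda>u. if u \<in> C then Some Broken else (m(v \<mapsto> Thick)) u);
       \<forall>u\<in>C. closely_nested (dom m') u v;
       marked_tubing G m' \<rbrakk> \<Longrightarrow> marking_move G m m'"

definition marked_tubing_le ::
  "('a, 'b) pre_digraph \<Rightarrow> ('a set \<rightharpoonup> marking) \<Rightarrow> ('a set \<rightharpoonup> marking) \<Rightarrow> bool" where
  "marked_tubing_le G m m' \<longleftrightarrow> (marking_move G)\<^sup>*\<^sup>* m' m"

section \<open>Face posets and combinatorial equivalence\<close>

definition order_isomorphic ::
  "'a set \<Rightarrow> ('a \<Rightarrow> 'a \<Rightarrow> bool) \<Rightarrow> 'b set \<Rightarrow> ('b \<Rightarrow> 'b \<Rightarrow> bool) \<Rightarrow> bool" where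
  "order_isomorphic A le_A B le_B \<longleftrightarrow>
     (\<exists>f. bij_betw f A B \<and> (\<forall>x\<in>A. \<forall>y\<in>A. le_A x y \<longleftrightarrow> le_B (f x) (f y)))"

definition nonempty_faces :: "'a::euclidean_space set \<Rightarrow> 'a set set" where
  "nonempty_faces P = {F. F face_of P \<and> F \<noteq> {}}"

definition combinatorially_equivalent ::
  "'a::euclidean_space set \<Rightarrow> 'b::euclidean_space set \<Rightarrow> bool" where
  "combinatorially_equivalent P Q \<longleftrightarrow>
     order_isomorphic (nonempty_faces P) (\<subseteq>) (nonempty_faces Q) (\<subseteq>)"

text \<open>
  The graph multiplihedron is determined only up to combinatorial equivalence, so it is rendered as
  a property of polytopes.
\<close>

definition graph_multiplihedron ::
  "('a, 'b) pre_digraph \<Rightarrow> 'c::euclidean_space set \<Rightarrow> bool" where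
  "graph_multiplihedron G P \<longleftrightarrow>
     polytope P \<and> aff_dim P = int (card (verts G)) \<and>
     order_isomorphic (nonempty_faces P) (\<subseteq>) {m. marked_tubing G m} (marked_tubing_le G)"

text \<open>The permutohedron in \<open>n\<close>-dimensional space, where \<open>n = CARD('n)\<close>.\<close>

definition permutohedron :: "(real ^ 'n) set" where
  "permutohedron =
     convex hull {\<chi> i. real (\<sigma> i) | \<sigma> :: 'n \<Rightarrow> nat. bij_betw \<sigma> UNIV {1..CARD('n)}}"

end

theory Submission
  imports Defs
begin

text \<open>
  Let \<open>V\<close> be the vertex set.  In a complete graph any two disjoint tubes are adjacent, so a tubing is a
  chain of nonempty sets ending in \<open>V\<close>, and a marking of it reads thin, \<dots>, thin, at most one broken,
  thick, \<dots>, thick from the inside out.  Such a marked chain amounts to a chain of nonempty subsets of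
  \<open>V \<union> {\<star>}\<close> containing the whole set: thin tubes are kept, \<open>\<star>\<close> is added to thick and broken ones, and
  if no tube is broken the set consisting of \<open>\<star>\<close> and the largest thin tube is inserted.  Every move
  enlarges this chain, and inserting a single set into the chain is a single move, so the order on
  marked tubings is reverse inclusion of chains.

  The vertices at which a linear functional \<open>a\<close> is maximal on the permutohedron are the rankings that
  are increasing with respect to \<open>a\<close>, that is, those mapping each sublevel set of \<open>a\<close> to an initial
  segment.  Hence the nonempty faces, too, correspond to chains of nonempty sets under reverse
  inclusion.
\<close>

section \<open>Flags of subsets\<close>

text \<open>For finite nonempty \<open>W\<close>, the successive differences along a flag form an
  ordered set partition of \<open>W\<close>, the usual label of a permutohedron face. With nested
  sets the order becomes plain reverse inclusion.\<close>

definition flags :: "'a set \<Rightarrow> 'a set set set" where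
  "flags W = {C. C \<subseteq> Pow W - {{}} \<and> W \<in> C \<and> (\<forall>X\<in>C. \<forall>Y\<in>C. X \<subseteq> Y \<or> Y \<subseteq> X)}"

lemma flagsD:
  assumes "C \<in> flags W"
  shows "\<And>X. X \<in> C \<Longrightarrow> X \<subseteq> W" "\<And>X. X \<in> C \<Longrightarrow> X \<noteq> {}" "W \<in> C"
    "\<And>X Y. X \<in> C \<Longrightarrow> Y \<in> C \<Longrightarrow> X \<subseteq> Y \<or> Y \<subseteq> X"
  using assms by (auto simp: flags_def)

lemma finite_flag: "C \<in> flags W \<Longrightarrow> finite W \<Longrightarrow> finite C"
  by (rule finite_subset[of C "Pow W"]) (auto simp: flags_def)

lemma flags_subset: "D \<in> flags W \<Longrightarrow> C \<subseteq> D \<Longrightarrow> W \<in> C \<Longrightarrow> C \<in> flags W"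
  unfolding flags_def mem_Collect_eq by (intro conjI ballI; (elim conjE)?; blast)

lemma order_isomorphic_trans:
  assumes "order_isomorphic A le_A B le_B" "order_isomorphic B le_B C le_C"
  shows "order_isomorphic A le_A C le_C"
proof -
  obtain f g where f: "bij_betw f A B" "\<forall>x\<in>A. \<forall>y\<in>A. le_A x y \<longleftrightarrow> le_B (f x) (f y)"
    and g: "bij_betw g B C" "\<forall>x\<in>B. \<forall>y\<in>B. le_B x y \<longleftrightarrow> le_C (g x) (g y)"
    using assms unfolding order_isomorphic_def by auto
  show ?thesis unfolding order_isomorphic_def
  proof (intro exI conjI ballI)
    show "bij_betw (g \<circ> f) A C" using bij_betw_trans[OF f(1) g(1)] .
    show "le_A x y \<longleftrightarrow> le_C ((g \<circ> f) x) ((g \<circ> f) y)" if "x \<in> A" "y \<in> A" for x y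
      using f g that by (simp add: bij_betwE)
  qed
qed

text \<open>Serves to carry flags of the vertex set with one point adjoined over to flags of the
  index type \<open>'n\<close>.\<close>

lemma order_isomorphic_flags:
  assumes "bij_betw h W W'"
  shows "order_isomorphic (flags W) (\<lambda>C D. D \<subseteq> C) (flags W') (\<lambda>C D. D \<subseteq> C)"
  unfolding order_isomorphic_def
proof (intro exI conjI ballI)
  let ?h = "image (image h)"
  have inj: "inj_on h W" and im: "h ` W = W'" using assms by (auto simp: bij_betw_def)
  have injP: "inj_on (image h) (Pow W)" using inj by (rule inj_on_image_Pow)
  have injPP: "inj_on ?h (Pow (Pow W))" using injP by (rule inj_on_image_Pow)
  have sub: "h ` X \<subseteq> h ` Y \<longleftrightarrow> X \<subseteq> Y" if "X \<subseteq> W" "Y \<subseteq> W" for X Y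
    using inj_on_image_subset_iff[OF inj that] .
  show "bij_betw ?h (flags W) (flags W')"
  proof (rule bij_betw_imageI)
    show "inj_on ?h (flags W)" by (rule inj_on_subset[OF injPP]) (auto simp: flags_def)
    show "?h ` flags W = flags W'"
    proof
      show "?h ` flags W \<subseteq> flags W'"
      proof
        fix D assume "D \<in> ?h ` flags W"
        then obtain C where C: "C \<in> flags W" and D: "D = ?h C" by auto
        show "D \<in> flags W'"
          unfolding flags_def D mem_Collect_eq
        proof (intro conjI ballI)
          show "?h C \<subseteq> Pow W' - {{}}" using flagsD(1,2)[OF C] im by blast
          show "W' \<in> ?h C" using flagsD(3)[OF C] im by blast
          show "X \<subseteq> Y \<or> Y \<subseteq> X" if "X \<in> ?h C" "Y \<in> ?h C" for X Y
            using that flagsD(4)[OF C] by (elim imageE) (simp, meson image_mono)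
        qed
      qed
      show "flags W' \<subseteq> ?h ` flags W"
      proof
        fix D assume D: "D \<in> flags W'"
        define C where "C = {X \<in> Pow W. h ` X \<in> D}"
        have "?h C = D"
        proof
          show "D \<subseteq> ?h C"
          proof
            fix Y assume "Y \<in> D"
            moreover then obtain X where "X \<subseteq> W" "Y = h ` X"
              using flagsD(1)[OF D] im by (meson subset_imageE)
            ultimately show "Y \<in> ?h C" by (auto simp: C_def)
          qed
        qed (auto simp: C_def)
        moreover have "C \<in> flags W"
          unfolding flags_def mem_Collect_eq
        proof (intro conjI ballI)
          show "C \<subseteq> Pow W - {{}}" using flagsD(2)[OF D] by (auto simp: C_def)
          show "W \<in> C" using flagsD(3)[OF D] im by (simp add: C_def)
          show "X \<subseteq> Y \<or> Y \<subseteq> X" if "X \<in> C" "Y \<in> C" for X Y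
            using that flagsD(4)[OF D, of "h ` X" "h ` Y"] sub by (simp add: C_def)
        qed
        ultimately show "D \<in> ?h ` flags W" by auto
      qed
    qed
  qed
  show "D \<subseteq> C \<longleftrightarrow> ?h D \<subseteq> ?h C" if "C \<in> flags W" "D \<in> flags W" for C D
    by (rule inj_on_image_subset_iff[OF injP, symmetric]) (use that in \<open>auto simp: flags_def\<close>)
qed

section \<open>Faces of the permutohedron\<close>

text \<open>The elements of \<open>S\<close> above \<open>card S\<close> are as many as the numbers
  up to \<open>card S\<close> missing from \<open>S\<close>, and each exceeds each missing number by
  at least 1. The summand \<open>card (S - {1..card S})\<close> records this surplus; it settles the
  equality case.\<close>

lemma sum_initial_le:
  fixes S :: "nat set"
  assumes "finite S" "0 \<notin> S"
  shows "\<Sum>{1..card S} + card (S - {1..card S}) \<le> \<Sum>S"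
proof -
  let ?K = "{1..card S}"
  have c: "card (S - ?K) = card (?K - S)"
    using card_Diff_subset_Int[of S ?K] card_Diff_subset_Int[of ?K S] assms(1)
    by (simp add: Int_commute)
  have "\<Sum>(?K - S) \<le> card (?K - S) * card S"
    using sum_bounded_above[of "?K - S" "\<lambda>x. x" "card S"] by auto
  moreover have "card (S - ?K) * Suc (card S) \<le> \<Sum>(S - ?K)"
    using sum_bounded_below[of "S - ?K" "Suc (card S)" "\<lambda>x. x"] assms(2)
    by (auto simp: not_less_eq_eq Suc_le_eq)
  moreover have "\<Sum>S = \<Sum>(S \<inter> ?K) + \<Sum>(S - ?K)"
    using sum.Int_Diff[OF assms(1), of "\<lambda>x. x"] by simp
  moreover have "\<Sum>?K = \<Sum>(S \<inter> ?K) + \<Sum>(?K - S)"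
    using sum.Int_Diff[of ?K "\<lambda>x. x" S] by (simp add: Int_commute)
  ultimately show ?thesis using c by simp
qed

lemma sum_eq_initial_iff:
  fixes S :: "nat set"
  assumes "finite S" "0 \<notin> S"
  shows "\<Sum>S = \<Sum>{1..card S} \<longleftrightarrow> S = {1..card S}"
proof
  assume "\<Sum>S = \<Sum>{1..card S}"
  then have "card (S - {1..card S}) = 0" using sum_initial_le[OF assms] by simp
  then have "S \<subseteq> {1..card S}" using assms by simp
  then show "S = {1..card S}" by (intro card_subset_eq) auto
qed simp

lemma down_closed_eq_initial:
  fixes S :: "nat set"
  assumes "finite S" "0 \<notin> S" "\<And>x y. x \<in> S \<Longrightarrow> 1 \<le> y \<Longrightarrow> y \<le> x \<Longrightarrow> y \<in> S"
  shows "S = {1..card S}"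
proof (cases "S = {}")
  case False
  have "S = {1..Max S}"
  proof
    show "S \<subseteq> {1..Max S}" using assms(1,2) by (auto simp: Suc_le_eq intro: gr0I)
    show "{1..Max S} \<subseteq> S" using assms(3)[OF Max_in[OF assms(1) False]] by auto
  qed
  then show ?thesis by (metis card_atLeastAtMost diff_Suc_1)
qed simp

section \<open>Rankings and the faces attached to flags\<close>

definition rankings :: "('n::finite \<Rightarrow> nat) set" where
  "rankings = {\<sigma>. bij_betw \<sigma> UNIV {1..CARD('n)}}"

definition vec_of :: "('n::finite \<Rightarrow> nat) \<Rightarrow> real ^ 'n" where
  "vec_of \<sigma> = (\<chi> i. real (\<sigma> i))"

text \<open>For a flag \<open>C\<close> these give the vertices of its face: the block between
  consecutive members occupies a fixed interval of ranks, in arbitrary order.\<close>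

definition adapted :: "'n::finite set set \<Rightarrow> ('n \<Rightarrow> nat) set" where
  "adapted C = {\<sigma>\<in>rankings. \<forall>S\<in>C. \<sigma> ` S = {1..card S}}"

definition flag_face :: "'n::finite set set \<Rightarrow> (real ^ 'n) set" where
  "flag_face C = convex hull (vec_of ` adapted C)"

lemma permutohedron_eq: "permutohedron = convex hull (vec_of ` rankings)"
  unfolding permutohedron_def vec_of_def rankings_def by (rule arg_cong[where f="\<lambda>x. convex hull x"]) auto

lemma finite_rankings: "finite (rankings :: ('n::finite \<Rightarrow> nat) set)"
proof (rule finite_subset)
  show "(rankings :: ('n \<Rightarrow> nat) set) \<subseteq> UNIV \<rightarrow>\<^sub>E {1..CARD('n)}"
    by (auto simp: rankings_def bij_betw_def)
qed (auto intro: finite_PiE)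

lemma rankings_nonempty: "(rankings :: ('n::finite \<Rightarrow> nat) set) \<noteq> {}"
  using ex_bij_betw_finite_nat[of "UNIV :: 'n set"]
    finite_same_card_bij[of "UNIV :: 'n set" "{1..CARD('n)}"]
  by (auto simp: rankings_def)

lemma rankingsD:
  assumes "(\<sigma> :: 'n::finite \<Rightarrow> nat) \<in> rankings"
  shows "inj \<sigma>" "\<sigma> i \<ge> 1" "\<sigma> i \<le> CARD('n)" "\<And>k. 1 \<le> k \<Longrightarrow> k \<le> CARD('n) \<Longrightarrow> \<exists>i. k = \<sigma> i"
    "card (\<sigma> ` S) = card S" "0 \<notin> \<sigma> ` S"
proof -
  have b: "inj \<sigma>" "range \<sigma> = {1..CARD('n)}" using assms by (auto simp: rankings_def bij_betw_def)
  then show "inj \<sigma>" "card (\<sigma> ` S) = card S" by (auto intro: card_image inj_on_subset)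
  have i: "\<sigma> i \<in> {1..CARD('n)}" for i using b by auto
  then show "\<sigma> i \<ge> 1" "\<sigma> i \<le> CARD('n)" by auto
  show "0 \<notin> \<sigma> ` S" by (metis i atLeastAtMost_iff imageE not_one_le_zero)
  show "\<And>k. 1 \<le> k \<Longrightarrow> k \<le> CARD('n) \<Longrightarrow> \<exists>i. k = \<sigma> i" using b by (metis atLeastAtMost_iff imageE)
qed

lemma rankings_transpose: "\<sigma> \<in> rankings \<Longrightarrow> \<sigma> \<circ> Transposition.transpose i j \<in> rankings"
  unfolding rankings_def using bij_betw_trans[OF bij_transpose] by auto

lemma sum_ranking:
  assumes "\<sigma> \<in> rankings"
  shows "(\<Sum>i\<in>S. real (\<sigma> i)) = real (\<Sum>(\<sigma> ` S))"
  using rankingsD(1)[OF assms] by (subst sum.reindex) (auto intro: inj_on_subset)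

lemma sum_ranking_ge:
  assumes "\<sigma> \<in> rankings"
  shows "real (\<Sum>{1..card S}) \<le> (\<Sum>i\<in>S. real (\<sigma> i))"
  unfolding sum_ranking[OF assms] of_nat_le_iff
  using sum_initial_le[of "\<sigma> ` S"] rankingsD(5,6)[OF assms, of S] by simp

lemma sum_ranking_eq_iff:
  assumes "\<sigma> \<in> rankings"
  shows "(\<Sum>i\<in>S. real (\<sigma> i)) = real (\<Sum>{1..card S}) \<longleftrightarrow> \<sigma> ` S = {1..card S}"
  unfolding sum_ranking[OF assms] of_nat_eq_iff
  using sum_eq_initial_iff[of "\<sigma> ` S"] rankingsD(5,6)[OF assms, of S] by simp

text \<open>Some subset of \<open>V\<close> spans \<open>F\<close>; enlarging it to
  \<open>F \<inter> V\<close> does not lead out of \<open>F\<close>, which is convex. A face is thus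
  known once its vertices are.\<close>

lemma face_of_convex_hull_eq:
  fixes V :: "'a::euclidean_space set"
  assumes "compact V" "F face_of convex hull V"
  shows "F = convex hull (F \<inter> V)"
proof -
  obtain S where S: "S \<subseteq> V" "F = convex hull S" using face_of_convex_hull_subset[OF assms] .
  then have "S \<subseteq> F \<inter> V" by (auto intro: hull_inc)
  then have "F \<subseteq> convex hull (F \<inter> V)" using S(2) hull_mono by metis
  moreover have "convex hull (F \<inter> V) \<subseteq> F"
    using face_of_imp_convex[OF assms(2)] by (simp add: hull_minimal)
  ultimately show ?thesis by blast
qed

lemma compact_vertices: "compact (vec_of ` rankings)"
  by (simp add: finite_imp_compact finite_rankings)

lemma inner_indicator_vec_of:
  "(\<chi> i. if i \<in> S then 1 else 0) \<bullet> vec_of \<sigma> = (\<Sum>i\<in>S. real (\<sigma> i))"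
  unfolding vec_of_def
  by (simp add: inner_vec_def if_distrib[of "\<lambda>x. x * _"] sum.If_cases cong: if_cong)

lemma flag_face_face_of:
  fixes C :: "'n::finite set set"
  shows "flag_face C face_of permutohedron"
proof -
  \<comment> \<open>Each \<open>\<Sum>\<^bsub>i\<in>S\<^esub> \<sigma> i\<close> attains its minimum exactly if \<open>\<sigma>\<close> maps \<open>S\<close> to an initial segment,
    hence so does the sum over all \<open>S \<in> C\<close>, which is the functional \<open>a\<close>.\<close>
  define a :: "real ^ 'n" where "a = (\<Sum>S\<in>C. \<chi> i. if i \<in> S then 1 else 0)"
  define b where "b = (\<Sum>S\<in>C. real (\<Sum>{1..card S}))"
  have av: "a \<bullet> vec_of \<sigma> = (\<Sum>S\<in>C. \<Sum>i\<in>S. real (\<sigma> i))" for \<sigma>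
    unfolding a_def by (simp add: inner_sum_left inner_indicator_vec_of)
  have ge: "b \<le> a \<bullet> vec_of \<sigma>" if "\<sigma> \<in> rankings" for \<sigma>
    unfolding b_def av using sum_ranking_ge[OF that] by (intro sum_mono)
  have eq: "a \<bullet> vec_of \<sigma> = b \<longleftrightarrow> \<sigma> \<in> adapted C" if "\<sigma> \<in> rankings" for \<sigma>
  proof
    assume "a \<bullet> vec_of \<sigma> = b"
    then have *: "(\<Sum>S\<in>C. real (\<Sum>{1..card S})) = (\<Sum>S\<in>C. \<Sum>i\<in>S. real (\<sigma> i))" unfolding av b_def by simp
    \<comment> \<open>Every summand is at least its bound, so equal totals force equality in each
      summand.\<close>
    have "(\<Sum>i\<in>S. real (\<sigma> i)) = real (\<Sum>{1..card S})" if "S \<in> C" for S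
      by (rule sum_mono_inv[OF *, symmetric]) (rule sum_ranking_ge[OF \<open>\<sigma> \<in> rankings\<close>], rule that, simp)
    then have "\<sigma> ` S = {1..card S}" if "S \<in> C" for S
      by (rule iffD1[OF sum_ranking_eq_iff[OF \<open>\<sigma> \<in> rankings\<close>]]) (simp only: that)
    then show "\<sigma> \<in> adapted C" using that unfolding adapted_def by blast
  next
    assume "\<sigma> \<in> adapted C"
    then show "a \<bullet> vec_of \<sigma> = b" unfolding av b_def adapted_def
      using sum_ranking_eq_iff[OF that] by (intro sum.cong) auto
  qed
  let ?P = "convex hull (vec_of ` (rankings :: ('n \<Rightarrow> nat) set))"
  have "?P \<subseteq> {x. b \<le> a \<bullet> x}"
    using ge by (intro hull_minimal) (auto simp: convex_halfspace_ge)
  then have F: "(?P \<inter> {x. a \<bullet> x = b}) face_of ?P"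
    by (intro face_of_Int_supporting_hyperplane_ge) auto
  have "(?P \<inter> {x. a \<bullet> x = b}) \<inter> vec_of ` rankings = vec_of ` adapted C"
  proof (intro set_eqI iffI)
    fix x assume "x \<in> (?P \<inter> {x. a \<bullet> x = b}) \<inter> vec_of ` rankings"
    then show "x \<in> vec_of ` adapted C" using eq by blast
  next
    fix x assume "x \<in> vec_of ` adapted C"
    then obtain \<sigma> where "x = vec_of \<sigma>" "\<sigma> \<in> adapted C" "\<sigma> \<in> rankings"
      by (auto simp: adapted_def)
    then show "x \<in> (?P \<inter> {x. a \<bullet> x = b}) \<inter> vec_of ` rankings"
      using eq by (auto intro: hull_inc)
  qed
  then have "flag_face C = ?P \<inter> {x. a \<bullet> x = b}"
    using face_of_convex_hull_eq[OF compact_vertices F] unfolding flag_face_def by simp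
  then show ?thesis using F unfolding permutohedron_eq by simp
qed

section \<open>Linear functionals and sorted rankings\<close>

text \<open>Exchange argument: if \<open>\<sigma> j < \<sigma> i\<close>, swapping these two values
  raises the sum by \<open>(a j - a i) * (\<sigma> i - \<sigma> j) > 0\<close>, against
  maximality.\<close>

lemma maximal_ranking_sorted:
  fixes a :: "'n::finite \<Rightarrow> real"
  assumes "\<sigma> \<in> rankings" "\<And>\<tau>. \<tau> \<in> rankings \<Longrightarrow> (\<Sum>i\<in>UNIV. a i * \<tau> i) \<le> (\<Sum>i\<in>UNIV. a i * \<sigma> i)"
    and "a i < a j"
  shows "\<sigma> i < \<sigma> j"
proof (rule ccontr)
  assume "\<not> \<sigma> i < \<sigma> j"
  moreover have ij: "i \<noteq> j" using assms(3) by auto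
  ultimately have gt: "\<sigma> j < \<sigma> i" using rankingsD(1)[OF assms(1)] by (metis injD linorder_neqE_nat)
  let ?\<tau> = "\<sigma> \<circ> Transposition.transpose i j"
  have split: "(\<Sum>k\<in>UNIV. f k) = f i + f j + (\<Sum>k\<in>UNIV - {i,j}. f k)" for f :: "'n \<Rightarrow> real"
    using sum.subset_diff[of "{i,j}" UNIV f] ij by simp
  have "(\<Sum>k\<in>UNIV - {i,j}. a k * ?\<tau> k) = (\<Sum>k\<in>UNIV - {i,j}. a k * \<sigma> k)"
    by (intro sum.cong) (auto simp: Transposition.transpose_def)
  then have "a i * \<sigma> j + a j * \<sigma> i \<le> a i * \<sigma> i + a j * \<sigma> j"
    using assms(2)[OF rankings_transpose[OF assms(1), of i j]]
    by (simp add: split[of "\<lambda>k. a k * _ k"])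
  then have "(a j - a i) * (real (\<sigma> i) - real (\<sigma> j)) \<le> 0" by (simp add: algebra_simps)
  then show False using gt assms(3) by (simp add: mult_le_0_iff)
qed

text \<open>A rank below that of some \<open>i \<in> S\<close> cannot belong to an element outside
  \<open>S\<close>, where \<open>a\<close> and hence \<open>\<sigma>\<close> is larger. So the ranks
  of \<open>S\<close> are closed downwards.\<close>

lemma sorted_image_initial:
  fixes a :: "'n::finite \<Rightarrow> real"
  assumes "\<sigma> \<in> rankings" "\<And>i j. a i < a j \<Longrightarrow> \<sigma> i < \<sigma> j"
    and "\<And>i j. i \<in> S \<Longrightarrow> j \<notin> S \<Longrightarrow> a i < a j"
  shows "\<sigma> ` S = {1..card S}"
proof -
  have "\<sigma> ` S = {1..card (\<sigma> ` S)}"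
  proof (rule down_closed_eq_initial)
    fix x y assume "x \<in> \<sigma> ` S" "1 \<le> y" "y \<le> x"
    then obtain i where i: "i \<in> S" "x = \<sigma> i" by auto
    then have "y \<le> CARD('n)" using \<open>y \<le> x\<close> rankingsD(3)[OF assms(1), of i] by simp
    then obtain j where j: "y = \<sigma> j" using rankingsD(4)[OF assms(1) \<open>1 \<le> y\<close>] by auto
    have "j \<in> S" using assms(2,3) i j \<open>y \<le> x\<close> by (meson not_le)
    then show "y \<in> \<sigma> ` S" using j by auto
  qed (use rankingsD(6)[OF assms(1)] in auto)
  then show ?thesis using rankingsD(5)[OF assms(1)] by simp
qed

text \<open>A flag consists of sublevel sets of a suitable functional, and a ranking that maximizes
  the functional is sorted by it, hence adapted.\<close>

lemma adapted_nonempty: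
  fixes C :: "'n::finite set set"
  assumes "C \<in> flags UNIV"
  shows "adapted C \<noteq> {}"
proof -
  \<comment> \<open>Counting the members that omit \<open>i\<close> gives a value that rises on
    leaving each member of the flag.\<close>
  define a where "a i = real (card {S\<in>C. i \<notin> S})" for i
  have fC: "finite C" using finite_flag[OF assms] by simp
  \<comment> \<open>A maximizer, written as a minimizer of the negated functional; it exists because
    there are finitely many rankings.\<close>
  obtain \<sigma> where s: "is_arg_min (\<lambda>\<sigma>. - (\<Sum>i\<in>UNIV. a i * real (\<sigma> i))) (\<lambda>\<sigma>. \<sigma> \<in> rankings) \<sigma>"
    using ex_is_arg_min_if_finite[OF finite_rankings rankings_nonempty] by metis
  then have sr: "\<sigma> \<in> rankings" by (simp add: is_arg_min_def)
  have sorted: "\<sigma> i < \<sigma> j" if "a i < a j" for i j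
    by (rule maximal_ranking_sorted[OF sr _ that]) (use s in \<open>simp add: is_arg_min_linorder\<close>)
  have "\<sigma> ` S = {1..card S}" if "S \<in> C" for S
  proof (rule sorted_image_initial[OF sr sorted])
    fix i j assume "i \<in> S" "j \<notin> S"
    then have "{S\<in>C. i \<notin> S} \<subseteq> {S\<in>C. j \<notin> S}" using flagsD(4)[OF assms that] by blast
    moreover have "S \<in> {S\<in>C. j \<notin> S} - {S\<in>C. i \<notin> S}" using that \<open>i \<in> S\<close> \<open>j \<notin> S\<close> by simp
    ultimately have "{S\<in>C. i \<notin> S} \<subset> {S\<in>C. j \<notin> S}" by blast
    then show "a i < a j" unfolding a_def using fC by (simp add: psubset_card_mono)
  qed
  then show ?thesis using sr unfolding adapted_def by auto
qed

text \<open>If an adapted \<open>\<sigma>\<close> happens to map \<open>S\<close> to an initial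
  segment, exchange the ranks \<open>card S\<close> and \<open>card S + 1\<close>. This spoils
  \<open>S\<close> but no member of \<open>C\<close>, since only \<open>S\<close> itself separates
  the two ranks.\<close>

lemma adapted_separates:
  fixes C :: "'n::finite set set"
  assumes "C \<in> flags UNIV" "S \<noteq> {}" "S \<notin> C"
  obtains \<sigma> where "\<sigma> \<in> adapted C" "\<sigma> ` S \<noteq> {1..card S}"
proof -
  obtain \<sigma> where s: "\<sigma> \<in> adapted C" using adapted_nonempty[OF assms(1)] by auto
  then have sr: "\<sigma> \<in> rankings" by (simp add: adapted_def)
  show thesis
  proof (cases "\<sigma> ` S = {1..card S}")
    case True
    let ?s = "card S"
    \<comment> \<open>Properness of \<open>S\<close> makes rank \<open>card S + 1\<close> available,
      nonemptiness rank \<open>card S\<close>.\<close>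
    have "S \<noteq> UNIV" using assms flagsD(3) by metis
    then have "?s < CARD('n)" by (metis finite_class.finite_UNIV psubsetI psubset_card_mono subset_UNIV)
    moreover have "1 \<le> ?s" using assms(2) by (simp add: Suc_le_eq card_gt_0_iff)
    ultimately obtain i j where i: "?s = \<sigma> i" and j: "Suc ?s = \<sigma> j"
      using rankingsD(4)[OF sr, of ?s] rankingsD(4)[OF sr, of "Suc ?s"] by auto
    let ?\<tau> = "\<sigma> \<circ> Transposition.transpose i j"
    have mem: "k \<in> T \<longleftrightarrow> \<sigma> k \<in> \<sigma> ` T" for k T using rankingsD(1)[OF sr] by (simp add: inj_image_mem_iff)
    have "?\<tau> ` T = {1..card T}" if T: "T \<in> C" for T
    proof -
      have sT: "\<sigma> ` T = {1..card T}" using s T by (simp add: adapted_def)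
      have "i \<in> T \<longleftrightarrow> j \<in> T"
      proof (rule ccontr)
        assume "\<not> ?thesis"
        \<comment> \<open>An initial segment containing exactly one of two consecutive ranks ends at
          the smaller one.\<close>
        then have "card T = ?s" using sT mem[of i T] mem[of j T] i j \<open>1 \<le> ?s\<close> by auto
        then have "\<sigma> ` T = \<sigma> ` S" using True sT by simp
        then have "T = S" using rankingsD(1)[OF sr] by (simp add: inj_image_eq_iff)
        then show False using T assms(3) by simp
      qed
      then have "Transposition.transpose i j ` T = T" by (rule transpose_image_eq)
      then show ?thesis using sT by (simp only: image_comp[symmetric])
    qed
    then have "?\<tau> \<in> adapted C" using rankings_transpose[OF sr] by (simp add: adapted_def)
    moreover have "?\<tau> ` S \<noteq> {1..?s}"
    proof
      assume "?\<tau> ` S = {1..?s}"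
      moreover have "i \<in> S" using mem[of i S] True i[symmetric] \<open>1 \<le> ?s\<close> by simp
      ultimately have "?\<tau> i \<in> {1..?s}" by blast
      then show False using j by simp
    qed
    ultimately show thesis by (rule that)
  qed (use s that in auto)
qed

text \<open>More sets leave fewer adapted rankings. Conversely, for \<open>S\<close> in
  \<open>D\<close> but not in \<open>C\<close>, the coordinate sum over \<open>S\<close> is constant
  on \<open>flag_face D\<close>, while a separating ranking adapted to \<open>C\<close> gives it
  another value.\<close>

lemma flag_face_subset_iff:
  fixes C :: "'n::finite set set"
  assumes "C \<in> flags UNIV" "D \<in> flags UNIV"
  shows "flag_face C \<subseteq> flag_face D \<longleftrightarrow> D \<subseteq> C"
proof
  assume "D \<subseteq> C"
  then have "adapted C \<subseteq> adapted D" by (auto simp: adapted_def)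
  then show "flag_face C \<subseteq> flag_face D" unfolding flag_face_def by (intro hull_mono image_mono)
next
  assume sub: "flag_face C \<subseteq> flag_face D"
  show "D \<subseteq> C"
  proof (rule subsetI, rule ccontr)
    fix S assume S: "S \<in> D" "S \<notin> C"
    then obtain \<sigma> where s: "\<sigma> \<in> adapted C" "\<sigma> ` S \<noteq> {1..card S}"
      using adapted_separates[OF assms(1)] flagsD(2)[OF assms(2)] by metis
    let ?a = "(\<chi> i. if i \<in> S then 1 else 0) :: real ^ 'n"
    note a = inner_indicator_vec_of[of S]
    have "flag_face D \<subseteq> {x. ?a \<bullet> x = real (\<Sum>{1..card S})}"
      unfolding flag_face_def
    proof (rule hull_minimal)
      show "vec_of ` adapted D \<subseteq> {x. ?a \<bullet> x = real (\<Sum>{1..card S})}"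
        using sum_ranking_eq_iff S(1) a by (fastforce simp: adapted_def)
    qed (rule convex_hyperplane)
    moreover have "vec_of \<sigma> \<in> flag_face C" unfolding flag_face_def using s by (auto intro: hull_inc)
    ultimately have "?a \<bullet> vec_of \<sigma> = real (\<Sum>{1..card S})" using sub by blast
    then show False using s sum_ranking_eq_iff[of \<sigma> S] by (simp add: a adapted_def)
  qed
qed

text \<open>Faces of a polytope are exposed, so \<open>F\<close> maximizes a functional
  \<open>a\<close>; its sublevel sets form \<open>C\<close>. Maximizers are adapted by the exchange
  argument. Conversely, an adapted ranking uses the same ranks on each level set of \<open>a\<close>
  as a maximizer \<open>\<tau>\<close> does, so it has the same value.\<close>

lemma face_of_permutohedron_flag:
  fixes F :: "(real ^ 'n::finite) set"
  assumes "F face_of permutohedron" "F \<noteq> {}"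
  obtains C where "C \<in> flags UNIV" "F = flag_face C"
proof -
  let ?P = "convex hull (vec_of ` (rankings :: ('n \<Rightarrow> nat) set))"
  have F: "F face_of ?P" using assms(1) unfolding permutohedron_eq .
  have "polyhedron ?P" by (intro polytope_imp_polyhedron polytope_convex_hull) (simp add: finite_rankings)
  then have "F exposed_face_of ?P" using F by (simp add: exposed_face_of_polyhedron)
  then obtain a b where ab: "?P \<subseteq> {x. a \<bullet> x \<le> b}" "F = ?P \<inter> {x. a \<bullet> x = b}"
    unfolding exposed_face_of_def by auto
  have av: "a \<bullet> vec_of \<sigma> = (\<Sum>i\<in>UNIV. a $ i * \<sigma> i)" for \<sigma> by (simp add: inner_vec_def vec_of_def)
  define M where "M = {\<sigma>\<in>rankings. a \<bullet> vec_of \<sigma> = b}"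
  have VM: "F \<inter> vec_of ` rankings = vec_of ` M"
    unfolding ab(2) M_def by (auto intro: hull_inc)
  have FM: "F = convex hull (vec_of ` M)"
    using face_of_convex_hull_eq[OF compact_vertices F] unfolding VM .
  define C where "C = range (\<lambda>i. {j. a $ j \<le> a $ i})"
  have le: "a \<bullet> vec_of \<sigma> \<le> b" if "\<sigma> \<in> rankings" for \<sigma>
    using subsetD[OF ab(1) hull_inc[OF imageI[OF that]]] by simp
  have MC: "\<sigma> \<in> adapted C" if "\<sigma> \<in> M" for \<sigma>
  proof -
    have sr: "\<sigma> \<in> rankings" and sb: "a \<bullet> vec_of \<sigma> = b" using that by (auto simp: M_def)
    have sorted: "\<sigma> i < \<sigma> j" if "a $ i < a $ j" for i j
      by (rule maximal_ranking_sorted[OF sr _ that]) (use le sb av in metis)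
    have "\<sigma> ` S = {1..card S}" if "S \<in> C" for S
      by (rule sorted_image_initial[of _ "\<lambda>i. a $ i", OF sr sorted]) (use that in \<open>auto simp: C_def\<close>)
    then show ?thesis using sr by (auto simp: adapted_def)
  qed
  obtain \<tau> where t: "\<tau> \<in> M" using assms(2) FM by auto
  have "\<sigma> \<in> M" if s: "\<sigma> \<in> adapted C" for \<sigma>
  proof -
    have sr: "\<sigma> \<in> rankings" and tr: "\<tau> \<in> rankings" using s t by (auto simp: adapted_def M_def)
    have same: "\<sigma> ` {j. a $ j \<le> a $ i} = \<tau> ` {j. a $ j \<le> a $ i}" for i
      using s MC[OF t] unfolding adapted_def C_def by blast
    have lev: "(\<Sum>i\<in>{i\<in>UNIV. a $ i = v}. a $ i * real (\<sigma> i)) = (\<Sum>i\<in>{i\<in>UNIV. a $ i = v}. a $ i * real (\<tau> i))" for v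
    proof -
      \<comment> \<open>A level set is a difference of unions of sublevel sets, and injective maps
        respect differences. The unions also handle a \<open>v\<close> that is not a value of
        \<open>a\<close> or has no smaller value.\<close>
      have im: "\<rho> ` {j. a $ j = v} =
          (\<Union>i\<in>{i. a $ i \<le> v}. \<rho> ` {j. a $ j \<le> a $ i}) - (\<Union>i\<in>{i. a $ i < v}. \<rho> ` {j. a $ j \<le> a $ i})"
        if "inj \<rho>" for \<rho> :: "'n \<Rightarrow> nat"
      proof -
        have "{j. a $ j = v} = (\<Union>i\<in>{i. a $ i \<le> v}. {j. a $ j \<le> a $ i}) - (\<Union>i\<in>{i. a $ i < v}. {j. a $ j \<le> a $ i})"
          by force
        then show ?thesis using that by (simp add: image_set_diff image_UN)
      qed
      have "\<sigma> ` {j. a $ j = v} = \<tau> ` {j. a $ j = v}"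
        using im[OF rankingsD(1)[OF sr]] im[OF rankingsD(1)[OF tr]] same by simp
      then have "(\<Sum>i\<in>{i. a $ i = v}. real (\<sigma> i)) = (\<Sum>i\<in>{i. a $ i = v}. real (\<tau> i))"
        using sum_ranking[OF sr] sum_ranking[OF tr] by simp
      then show ?thesis by (simp add: sum_distrib_left[symmetric])
    qed
    have "(\<Sum>i\<in>UNIV. a $ i * real (\<sigma> i)) = (\<Sum>i\<in>UNIV. a $ i * real (\<tau> i))"
      unfolding sum.image_gen[of UNIV _ "\<lambda>i. a $ i", OF finite_class.finite_UNIV] lev ..
    then show ?thesis using t sr unfolding M_def av by simp
  qed
  then have "M = adapted C" using MC by auto
  then have "F = flag_face C" using FM by (simp add: flag_face_def)
  moreover have "C \<in> flags UNIV"
  proof -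
    have fin: "finite (range (\<lambda>i. a $ i))" by simp
    obtain i where "a $ i = Max (range (\<lambda>i. a $ i))" using Max_in[OF fin] by fastforce
    then have "{j. a $ j \<le> a $ i} = UNIV" using Max_ge[OF fin] by auto
    then have "UNIV \<in> C" unfolding C_def by (metis rangeI)
    then show ?thesis unfolding flags_def C_def by (auto intro: order_trans)
  qed
  ultimately show thesis using that by blast
qed

lemma order_isomorphic_flags_faces:
  "order_isomorphic (flags (UNIV :: 'n::finite set)) (\<lambda>C D. D \<subseteq> C)
     (nonempty_faces (permutohedron :: (real ^ 'n) set)) (\<subseteq>)"
  unfolding order_isomorphic_def
proof (intro exI conjI ballI)
  show "bij_betw flag_face (flags UNIV) (nonempty_faces (permutohedron :: (real ^ 'n) set))"
  proof (rule bij_betw_imageI)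
    show "inj_on flag_face (flags (UNIV :: 'n set))"
      by (rule inj_onI) (metis flag_face_subset_iff order_refl subset_antisym)
    show "flag_face ` flags (UNIV :: 'n set) = nonempty_faces permutohedron"
    proof
      show "flag_face ` flags (UNIV :: 'n set) \<subseteq> nonempty_faces permutohedron"
        using flag_face_face_of adapted_nonempty unfolding nonempty_faces_def flag_face_def by force
      show "nonempty_faces permutohedron \<subseteq> flag_face ` flags (UNIV :: 'n set)"
        unfolding nonempty_faces_def using face_of_permutohedron_flag by blast
    qed
  qed
qed (simp add: flag_face_subset_iff)

section \<open>Marked tubings of complete graphs\<close>

text \<open>The graph-free form of a marked tubing when every nonempty vertex set is a tube.\<close>

definition marked_chain :: "'a set \<Rightarrow> ('a set \<rightharpoonup> marking) \<Rightarrow> bool" where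
  "marked_chain V m \<longleftrightarrow> dom m \<in> flags V \<and>
     (\<forall>u\<in>dom m. \<forall>v\<in>dom m. u \<subset> v \<and> m v \<noteq> Some Thick \<longrightarrow> m u = Some Thin)"

lemma complete_induce_connected:
  assumes "complete_digraph k G" "u \<subseteq> verts G" "u \<noteq> {}"
  shows "Digraph_Component.connected (G \<restriction> u)"
proof -
  interpret graph G using assms(1) by (simp add: complete_digraph_def)
  have "x \<rightarrow>\<^sup>*\<^bsub>mk_symmetric (G \<restriction> u)\<^esub> y" if xy: "x \<in> u" "y \<in> u" for x y
  proof (cases "x = y")
    case True
    then show ?thesis using xy by (simp add: reachable_def)
  next
    case False
    then have "(x, y) \<in> arcs_ends G" using assms(1,2) xy by (auto simp: complete_digraph_def)
    then obtain e where e: "e \<in> arcs G" "tail G e = x" "head G e = y"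
      by (auto simp: arcs_ends_conv)
    then have "(x, y) \<in> parcs (mk_symmetric (G \<restriction> u))"
      using xy by (force simp: parcs_mk_symmetric)
    then show ?thesis using xy by (auto simp: reachable_def intro: rtrancl_on.intros)
  qed
  then show ?thesis
    using assms(3) unfolding Digraph_Component.connected_def by (auto simp: strongly_connected_def)
qed

text \<open>The union of two disjoint tubes is again a tube, so disjoint tubes are adjacent and
  compatibility means comparability. The clause on components is vacuous because \<open>G\<close> is
  connected.\<close>

lemma complete_marked_tubing_iff:
  assumes "complete_digraph k G" "verts G \<noteq> {}"
  shows "marked_tubing G m \<longleftrightarrow> marked_chain (verts G) m"
proof -
  interpret graph G using assms(1) by (simp add: complete_digraph_def)
  have tube: "tube G u \<longleftrightarrow> u \<subseteq> verts G \<and> u \<noteq> {}" for u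
    using complete_induce_connected[OF assms(1)] assms(2) by (auto simp: tube_def universal_tube_def)
  have "G \<restriction> verts G = G"
    by (rule pre_digraph.equality) (auto simp: induce_subgraph_def)
  then have conn: "Digraph_Component.connected G"
    using complete_induce_connected[OF assms(1) subset_refl assms(2)] by simp
  \<comment> \<open>By definition a nonempty set intersects itself, hence the restriction to
    distinct tubes; \<open>pairwise\<close> asks for no more.\<close>
  have compat: "tubes_compatible G u v \<longleftrightarrow> u \<subseteq> v \<or> v \<subseteq> u"
    if "u \<subseteq> verts G" "u \<noteq> {}" "v \<subseteq> verts G" "v \<noteq> {}" "u \<noteq> v" for u v
    using that by (auto simp: tubes_compatible_def tubes_intersect_def tubes_adjacent_def tube)
  have "tubing G T \<longleftrightarrow> T \<in> flags (verts G)" for T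
  proof -
    have pw: "pairwise (tubes_compatible G) T \<longleftrightarrow> (\<forall>X\<in>T. \<forall>Y\<in>T. X \<subseteq> Y \<or> Y \<subseteq> X)"
      if "\<forall>u\<in>T. u \<subseteq> verts G \<and> u \<noteq> {}"
      unfolding pairwise_def using compat that by (metis subset_refl)
    have sub: "T \<subseteq> Pow (verts G) - {{}} \<longleftrightarrow> (\<forall>u\<in>T. u \<subseteq> verts G \<and> u \<noteq> {})" by auto
    show ?thesis
      unfolding tubing_def tube universal_tube_def flags_def mem_Collect_eq sub
      by (cases "\<forall>u\<in>T. u \<subseteq> verts G \<and> u \<noteq> {}") (simp_all only: pw conn simp_thms conj_ac)
  qed
  then show ?thesis by (simp add: marked_tubing_def marked_chain_def)
qed

section \<open>Subsets of the vertex set with an extra point\<close>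

text \<open>\<open>None\<close> serves as the adjoined point, so it is fresh by typing.\<close>

definition add_None :: "'a set \<Rightarrow> 'a option set" where
  "add_None A = insert None (Some ` A)"

lemma add_None_simps [simp]:
  "add_None A \<subseteq> add_None B \<longleftrightarrow> A \<subseteq> B" "Some ` A \<subseteq> add_None B \<longleftrightarrow> A \<subseteq> B"
  "\<not> add_None A \<subseteq> Some ` B" "Some ` A \<subseteq> Some ` B \<longleftrightarrow> A \<subseteq> B"
  "add_None A = add_None B \<longleftrightarrow> A = B" "Some ` A \<noteq> add_None B" "add_None B \<noteq> Some ` A"
  "add_None A \<noteq> {}" "{} \<noteq> add_None A" "Some ` A = Some ` B \<longleftrightarrow> A = B"
  by (auto simp: add_None_def)

lemma option_set_cases:
  obtains A where "X = Some ` A" | A where "X = add_None A"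
proof -
  have "x \<in> X \<longleftrightarrow> x \<in> (if None \<in> X then add_None (Some -` X) else Some ` (Some -` X))" for x
    by (cases x) (auto simp: add_None_def)
  then have "X = (if None \<in> X then add_None (Some -` X) else Some ` (Some -` X))" by blast
  then show thesis using that by metis
qed

text \<open>The mixed clause is one-sided because a set with \<open>None\<close> never lies inside
  one without it. In \<open>add_None A\<close> the set \<open>A\<close> may be empty.\<close>

lemma flags_add_None_iff:
  "C \<in> flags (add_None V) \<longleftrightarrow>
     (\<forall>A. Some ` A \<in> C \<longrightarrow> A \<noteq> {} \<and> A \<subseteq> V) \<and> (\<forall>A. add_None A \<in> C \<longrightarrow> A \<subseteq> V) \<and> add_None V \<in> C \<and>
     (\<forall>A B. Some ` A \<in> C \<longrightarrow> Some ` B \<in> C \<longrightarrow> A \<subseteq> B \<or> B \<subseteq> A) \<and>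
     (\<forall>A B. add_None A \<in> C \<longrightarrow> add_None B \<in> C \<longrightarrow> A \<subseteq> B \<or> B \<subseteq> A) \<and>
     (\<forall>A B. Some ` A \<in> C \<longrightarrow> add_None B \<in> C \<longrightarrow> A \<subseteq> B)" (is "?L \<longleftrightarrow> ?R")
proof
  assume C: ?L
  note D = flagsD[OF C]
  show ?R
  proof (intro conjI allI impI)
    fix A B
    show "A \<noteq> {}" "A \<subseteq> V" if "Some ` A \<in> C" using D(1,2)[OF that] by simp_all
    show "A \<subseteq> V" if "add_None A \<in> C" using D(1)[OF that] by simp
    show "A \<subseteq> B \<or> B \<subseteq> A" if "Some ` A \<in> C" "Some ` B \<in> C" using D(4)[OF that] by simp
    show "A \<subseteq> B \<or> B \<subseteq> A" if "add_None A \<in> C" "add_None B \<in> C" using D(4)[OF that] by simp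
    show "A \<subseteq> B" if "Some ` A \<in> C" "add_None B \<in> C" using D(4)[OF that] by simp
  qed (rule D(3))
next
  assume R: ?R
  have "X \<subseteq> add_None V \<and> X \<noteq> {}" if "X \<in> C" for X
    using R that by (cases X rule: option_set_cases) auto
  moreover have "X \<subseteq> Y \<or> Y \<subseteq> X" if "X \<in> C" "Y \<in> C" for X Y
    using R that by (cases X rule: option_set_cases; cases Y rule: option_set_cases) auto
  ultimately show ?L using R by (auto simp: flags_def)
qed

lemma flags_add_NoneD:
  assumes "C \<in> flags (add_None V)"
  shows "\<And>A. Some ` A \<in> C \<Longrightarrow> A \<noteq> {} \<and> A \<subseteq> V" "\<And>A. add_None A \<in> C \<Longrightarrow> A \<subseteq> V"
    "add_None V \<in> C"
    "\<And>A B. Some ` A \<in> C \<Longrightarrow> Some ` B \<in> C \<Longrightarrow> A \<subseteq> B \<or> B \<subseteq> A"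
    "\<And>A B. add_None A \<in> C \<Longrightarrow> add_None B \<in> C \<Longrightarrow> A \<subseteq> B \<or> B \<subseteq> A"
    "\<And>A B. Some ` A \<in> C \<Longrightarrow> add_None B \<in> C \<Longrightarrow> A \<subseteq> B"
  using assms by (simp_all add: flags_add_None_iff)

text \<open>
  The pivot is the union of the tubes that are not thick.  It is the broken tube if there is one, and
  otherwise the largest thin tube, or empty if all tubes are thick.
\<close>

definition pivot :: "('a set \<rightharpoonup> marking) \<Rightarrow> 'a set" where
  "pivot m = \<Union>{A. m A = Some Thin \<or> m A = Some Broken}"

text \<open>A broken tube needs no clause of its own, being the pivot; otherwise the last term
  supplies the extra set.\<close>

definition encode :: "('a set \<rightharpoonup> marking) \<Rightarrow> 'a option set set" where
  "encode m = {Some ` A |A. m A = Some Thin} \<union> {add_None A |A. m A = Some Thick} \<union> {add_None (pivot m)}"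

text \<open>Inverse of \<open>encode\<close>. Testing for thin first matters when the pivot is thin,
  as then both forms of it are present. The test \<open>A \<noteq> {}\<close> discards the pivot
  \<open>{}\<close>, and the least remaining \<open>add_None A\<close> comes from a broken
  tube.\<close>

definition decode :: "'a option set set \<Rightarrow> 'a set \<rightharpoonup> marking" where
  "decode C A =
     (if Some ` A \<in> C then Some Thin
      else if A \<noteq> {} \<and> add_None A \<in> C
        then Some (if \<exists>B. add_None B \<in> C \<and> B \<subset> A then Thick else Broken)
      else None)"

lemma in_encode_iff [simp]:
  "Some ` A \<in> encode m \<longleftrightarrow> m A = Some Thin"
  "add_None A \<in> encode m \<longleftrightarrow> m A = Some Thick \<or> A = pivot m"
  by (auto simp: encode_def)

lemma option_sets_eqI:
  assumes "\<And>A. Some ` A \<in> C \<longleftrightarrow> Some ` A \<in> D" "\<And>A. add_None A \<in> C \<longleftrightarrow> add_None A \<in> D"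
  shows "C = D"
  by (rule set_eqI) (metis assms option_set_cases)

lemma option_sets_subsetI:
  assumes "\<And>A. Some ` A \<in> C \<Longrightarrow> Some ` A \<in> D" "\<And>A. add_None A \<in> C \<Longrightarrow> add_None A \<in> D"
  shows "C \<subseteq> D"
  by (rule subsetI) (metis assms option_set_cases)

lemma marked_chainD:
  assumes "marked_chain V m"
  shows "\<And>A k. m A = Some k \<Longrightarrow> A \<subseteq> V \<and> A \<noteq> {}" "\<exists>k. m V = Some k"
    "\<And>A B k l. m A = Some k \<Longrightarrow> m B = Some l \<Longrightarrow> A \<subseteq> B \<or> B \<subseteq> A"
    "\<And>A B k l. m A = Some k \<Longrightarrow> m B = Some l \<Longrightarrow> A \<subset> B \<Longrightarrow> l \<noteq> Thick \<Longrightarrow> k = Thin"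
proof -
  have fl: "dom m \<in> flags V"
    and mk: "\<And>u v. u \<in> dom m \<Longrightarrow> v \<in> dom m \<Longrightarrow> u \<subset> v \<Longrightarrow> m v \<noteq> Some Thick \<Longrightarrow> m u = Some Thin"
    using assms unfolding marked_chain_def by blast+
  show "\<exists>k. m V = Some k" using flagsD(3)[OF fl] by blast
  fix A B k l
  assume A: "m A = Some k"
  then show "A \<subseteq> V \<and> A \<noteq> {}" using flagsD(1,2)[OF fl, of A] by blast
  assume B: "m B = Some l"
  show "A \<subseteq> B \<or> B \<subseteq> A" using flagsD(4)[OF fl, of A B] A B by blast
  assume "A \<subset> B" "l \<noteq> Thick"
  then show "k = Thin" using mk[of A B] A B by (simp add: domIff)
qed

lemma subset_pivot: "m A = Some Thin \<or> m A = Some Broken \<Longrightarrow> A \<subseteq> pivot m"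
  by (auto simp: pivot_def)

section \<open>Marked chains and flags determine each other\<close>

context
  fixes V :: "'a set"
  assumes V: "finite V" "V \<noteq> {}"
begin

text \<open>The tubes that are not thick form a finite chain, so their union is one of them unless
  there are none.\<close>

lemma pivot_cases:
  assumes m: "marked_chain V m"
  obtains "pivot m = {}" "\<And>A. m A \<noteq> Some Thin \<and> m A \<noteq> Some Broken"
  | "m (pivot m) = Some Thin" | "m (pivot m) = Some Broken"
proof (cases "{A. m A = Some Thin \<or> m A = Some Broken} = {}")
  case True
  then show thesis using that(1) by (auto simp: pivot_def)
next
  case False
  let ?S = "{A. m A = Some Thin \<or> m A = Some Broken}"
  have "finite ?S"
    by (rule finite_subset[of _ "Pow V"]) (use V marked_chainD(1)[OF m] in auto)
  moreover have "subset.chain UNIV ?S"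
    unfolding subset_chain_def using marked_chainD(3)[OF m] by blast
  ultimately have "\<Union>?S \<in> ?S" using False by (intro Union_in_chain)
  then show thesis using that(2,3) by (auto simp: pivot_def)
qed

text \<open>A broken tube strictly inside a pivot that is not thick would have to be thin.\<close>

lemma broken_pivot:
  assumes "marked_chain V m" "m A = Some Broken"
  shows "pivot m = A"
proof (rule ccontr)
  assume ne: "pivot m \<noteq> A"
  then have sub: "A \<subset> pivot m" using subset_pivot[of m A] assms(2) by blast
  note D = marked_chainD(4)[OF assms(1,2) _ sub]
  show False
  proof (cases rule: pivot_cases[OF assms(1)])
    case 1
    then show False using assms(2) by blast
  next
    case 2
    then show False using D[OF 2] by simp
  next
    case 3
    then show False using D[OF 3] by simp
  qed
qed

lemma pivot_subset_thick:
  assumes "marked_chain V m" "m A = Some Thick"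
  shows "pivot m \<subset> A"
proof -
  note D = marked_chainD[OF assms(1)]
  have *: "pivot m \<subset> A" if p: "m (pivot m) = Some k" and k: "k \<noteq> Thick" for k
  proof -
    have "pivot m \<noteq> A" using p k assms(2) by auto
    moreover have "\<not> A \<subset> pivot m" using D(4)[OF assms(2) p] k by blast
    ultimately show ?thesis using D(3)[OF p assms(2)] by blast
  qed
  show ?thesis
  proof (cases rule: pivot_cases[OF assms(1)])
    case 1
    then show ?thesis using D(1)[OF assms(2)] by auto
  qed (use * in auto)
qed

text \<open>All comparisons follow from thin tubes lying inside the pivot and the pivot inside every
  thick tube.\<close>

lemma encode_in_flags:
  assumes m: "marked_chain V m"
  shows "encode m \<in> flags (add_None V)"
  unfolding flags_add_None_iff in_encode_iff
proof (intro conjI allI impI)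
  note D = marked_chainD[OF m]
  have p: "pivot m \<subseteq> V" unfolding pivot_def using D(1) by auto
  fix A B
  show "A \<noteq> {}" "A \<subseteq> V" if "m A = Some Thin" using D(1)[OF that] by auto
  show "A \<subseteq> V" if "m A = Some Thick \<or> A = pivot m" using that p D(1) by auto
  show "m V = Some Thick \<or> V = pivot m"
    using D(2) subset_pivot[of m V] p by (metis marking.exhaust subset_antisym)
  show "A \<subseteq> B \<or> B \<subseteq> A" if "m A = Some Thin" "m B = Some Thin" using D(3)[OF that] .
  show "A \<subseteq> B \<or> B \<subseteq> A" if "m A = Some Thick \<or> A = pivot m" "m B = Some Thick \<or> B = pivot m"
    using that D(3) pivot_subset_thick[OF m] by blast
  show "A \<subseteq> B" if "m A = Some Thin" "m B = Some Thick \<or> B = pivot m"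
    using that subset_pivot[of m A] pivot_subset_thick[OF m] by blast
qed

lemma decode_encode:
  assumes m: "marked_chain V m"
  shows "decode (encode m) = m"
proof
  fix A
  note D = marked_chainD[OF m]
  show "decode (encode m) A = m A"
  proof (cases "m A")
    case None
    \<comment> \<open>An unmarked pivot is empty: all tubes are thick.\<close>
    have "A = {}" if "A = pivot m"
      by (cases rule: pivot_cases[OF m]) (use None that in auto)
    then show ?thesis using None by (auto simp: decode_def)
  next
    case (Some k)
    show ?thesis
    proof (cases k)
      case Broken
      then have A: "A = pivot m" using broken_pivot[OF m] Some by simp
      have "\<not> (\<exists>B. add_None B \<in> encode m \<and> B \<subset> A)"
        using pivot_subset_thick[OF m] A by auto
      then show ?thesis using Some Broken D(1)[OF Some] A by (auto simp: decode_def)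
    next
      case Thick
      then show ?thesis using Some D(1)[OF Some] pivot_subset_thick[OF m, of A] by (auto simp: decode_def)
    qed (use Some in \<open>simp add: decode_def\<close>)
  qed
qed

text \<open>This \<open>K\<close> turns out to be the pivot of \<open>decode C\<close>.\<close>

lemma least_None:
  assumes C: "C \<in> flags (add_None V)"
  obtains K where "add_None K \<in> C" "\<And>B. add_None B \<in> C \<Longrightarrow> K \<subseteq> B"
proof -
  let ?S = "{A. add_None A \<in> C}"
  have "finite ?S"
    by (rule finite_subset[of _ "Pow V"]) (use V C in \<open>auto simp: flags_add_None_iff\<close>)
  moreover have "?S \<noteq> {}" using C by (auto simp: flags_add_None_iff)
  moreover have "subset.chain UNIV ?S"
    unfolding subset_chain_def using flags_add_NoneD(5)[OF C] by blast
  ultimately have "\<Inter>?S \<in> ?S" by (intro Inter_in_chain)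
  then show thesis using that[of "\<Inter>?S"] by auto
qed

lemma decode_marked_chain:
  assumes C: "C \<in> flags (add_None V)"
  shows "marked_chain V (decode C)"
proof -
  note D = flags_add_NoneD[OF C]
  have dom: "dom (decode C) = {A. Some ` A \<in> C \<or> A \<noteq> {} \<and> add_None A \<in> C}"
    by (auto simp: decode_def split: if_splits)
  have "dom (decode C) \<in> flags V"
  proof -
    have "V \<in> dom (decode C)" unfolding dom using D(3) V by simp
    moreover have "X \<subseteq> Y \<or> Y \<subseteq> X" if "X \<in> dom (decode C)" "Y \<in> dom (decode C)" for X Y
      using that D(4,5)[of X Y] D(6)[of X Y] D(6)[of Y X] unfolding dom by blast
    moreover have "dom (decode C) \<subseteq> Pow V - {{}}" unfolding dom using D(1,2) by auto
    ultimately show ?thesis by (simp add: flags_def)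
  qed
  moreover have "decode C u = Some Thin"
    if "u \<in> dom (decode C)" "v \<in> dom (decode C)" "u \<subset> v" "decode C v \<noteq> Some Thick" for u v
  proof (rule ccontr)
    assume "decode C u \<noteq> Some Thin"
    then have u: "add_None u \<in> C" "Some ` u \<notin> C" using that(1) unfolding dom by (auto simp: decode_def)
    then have "Some ` v \<notin> C" using D(6)[of v u] that(3) by blast
    then show False using that(2-4) u unfolding dom by (auto simp: decode_def split: if_splits)
  qed
  ultimately show ?thesis unfolding marked_chain_def by blast
qed

lemma decode_pivot:
  assumes C: "C \<in> flags (add_None V)" and K: "add_None K \<in> C" "\<And>B. add_None B \<in> C \<Longrightarrow> K \<subseteq> B"
  shows "pivot (decode C) = K"
proof
  have "A \<subseteq> K" if "decode C A = Some Thin \<or> decode C A = Some Broken" for A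
  proof (cases "Some ` A \<in> C")
    case True
    then show ?thesis using flags_add_NoneD(6)[OF C] K(1) by blast
  next
    case False
    then have "add_None A \<in> C" "\<not> K \<subset> A" using that K(1) by (auto simp: decode_def split: if_splits)
    then show ?thesis using K(2) by blast
  qed
  then show "pivot (decode C) \<subseteq> K" unfolding pivot_def by blast
  have "decode C K = Some Thin \<or> decode C K = Some Broken" if "K \<noteq> {}"
    using that K by (auto simp: decode_def)
  then show "K \<subseteq> pivot (decode C)" using subset_pivot by blast
qed

lemma encode_decode:
  assumes C: "C \<in> flags (add_None V)"
  shows "encode (decode C) = C"
proof (rule option_sets_eqI)
  fix A
  show "Some ` A \<in> encode (decode C) \<longleftrightarrow> Some ` A \<in> C" by (simp add: decode_def)
  obtain K where K: "add_None K \<in> C" "\<And>B. add_None B \<in> C \<Longrightarrow> K \<subseteq> B" using least_None[OF C] by blast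
  have "Some ` A \<notin> C" if "add_None A \<in> C" "A \<noteq> K"
    using that K(2)[of A] flags_add_NoneD(6)[OF C _ K(1), of A] by blast
  moreover have "K \<subset> A \<and> A \<noteq> {}" if "add_None A \<in> C" "A \<noteq> K" using that K(2)[of A] by blast
  ultimately have "decode C A = Some Thick" if "add_None A \<in> C" "A \<noteq> K"
    using that K(1) by (auto simp: decode_def)
  moreover have "add_None A \<in> C" if "decode C A = Some Thick"
    using that by (auto simp: decode_def split: if_splits)
  ultimately show "add_None A \<in> encode (decode C) \<longleftrightarrow> add_None A \<in> C"
    using K(1) decode_pivot[OF C K] by auto
qed

end

section \<open>Moves as insertions into the flag\<close>

text \<open>A resolved or split broken tube is the old pivot; its set with \<open>None\<close>
  survives because the tube becomes thick or remains the pivot. Adding a thin or thick tube leaves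
  the pivot unchanged.\<close>

lemma marking_move_encode:
  assumes V: "finite V" "V \<noteq> {}" and mt: "\<And>m. marked_tubing G m \<longleftrightarrow> marked_chain V m"
    and "marking_move G m m'"
  shows "encode m \<subseteq> encode m'"
  using assms(4)
proof cases
  case (resolve_broken u k)
  have m: "marked_chain V m" "marked_chain V m'" using resolve_broken mt by auto
  have p: "pivot m = u" using broken_pivot[OF V m(1)] resolve_broken by simp
  have "m' u = Some Thick \<or> u = pivot m'"
  proof (cases "k = Thin")
    case True
    then have "{A. m A = Some Thin \<or> m A = Some Broken} = {A. m' A = Some Thin \<or> m' A = Some Broken}"
      using resolve_broken by auto
    then show ?thesis using p by (simp add: pivot_def)
  qed (use resolve_broken in auto)
  then show ?thesis using resolve_broken p by (intro option_sets_subsetI) auto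
next
  case (add_thin v u)
  have "pivot m' = u \<union> pivot m" unfolding pivot_def using add_thin by auto
  then have "pivot m' = pivot m" using add_thin subset_pivot[of m v] by auto
  then show ?thesis using add_thin by (intro option_sets_subsetI) auto
next
  case (add_thick v u)
  have "pivot m' = pivot m" unfolding pivot_def using add_thick
    by (intro arg_cong[where f=Union]) auto
  then show ?thesis using add_thick by (intro option_sets_subsetI) auto
next
  case (split_broken v C)
  have "pivot m = v" using broken_pivot[OF V] split_broken mt by auto
  then show ?thesis using split_broken by (intro option_sets_subsetI) auto
qed

lemma marking_move_decode_insert:
  assumes V: "finite V" "V \<noteq> {}" and mt: "\<And>m. marked_tubing G m \<longleftrightarrow> marked_chain V m"
    and C: "C \<in> flags (add_None V)" and D: "insert X C \<in> flags (add_None V)" and X: "X \<notin> C"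
  shows "marking_move G (decode C) (decode (insert X C))"
proof -
  let ?m = "decode C" and ?m' = "decode (insert X C)"
  have m: "marked_tubing G ?m" "marked_tubing G ?m'"
    using mt decode_marked_chain[OF V] C D by auto
  obtain K where K: "add_None K \<in> C" "\<And>B. add_None B \<in> C \<Longrightarrow> K \<subseteq> B" using least_None[OF V C] by blast
  note D' = flags_add_NoneD[OF D]
  have mK: "?m K = Some (if Some ` K \<in> C then Thin else Broken)" if "K \<noteq> {}"
    using that K by (auto simp: decode_def)
  show ?thesis
  proof (cases X rule: option_set_cases)
    case (1 A)
    have A: "A \<noteq> {}" "A \<subseteq> K" using D'(1,6)[of A] K(1) 1 by auto
    have m': "?m' = ?m(A \<mapsto> Thin)"
      using 1 by (auto simp: decode_def fun_eq_iff)
    show ?thesis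
    proof (cases "add_None A \<in> C")
      case True
      \<comment> \<open>Minimality of \<open>K\<close> gives \<open>A = K\<close>.\<close>
      then have "?m A = Some Broken" using K A X 1 by (auto simp: decode_def)
      then show ?thesis using m m' by (intro resolve_broken) auto
    next
      case False
      then have "A \<subset> K" "A \<notin> dom ?m" using A K(1) X 1 by (auto simp: decode_def)
      moreover have "K \<noteq> {}" using A by blast
      then have "?m K = Some Thin \<or> ?m K = Some Broken" using mK by (simp split: if_split)
      ultimately show ?thesis using m m' by (intro add_thin[of G ?m K A]) auto
    qed
  next
    case (2 A)
    have AK: "A \<noteq> K" using X K 2 by auto
    then consider "A \<subset> K" | "K \<subset> A" using D'(5)[of A K] K(1) 2 by blast
    then show ?thesis
    proof cases
      case 1
      have K0: "K \<noteq> {}" "Some ` K \<notin> C" using 1 D'(6)[of K A] \<open>X = add_None A\<close> by auto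
      then have KB: "?m K = Some Broken" using mK by simp
      have m'K: "?m' K = Some Thick" using K0 K 1 \<open>X = add_None A\<close> by (auto simp: decode_def)
      \<comment> \<open>Such a \<open>B\<close> with \<open>add_None B\<close> in \<open>C\<close>
        lies strictly above \<open>K\<close>, so it was thick or thin already and the smaller set
        \<open>A\<close> changes nothing.\<close>
      have rest: "?m' B = ?m B" if "B \<noteq> A" "B \<noteq> K" for B
      proof -
        have "K \<subset> B" if "add_None B \<in> C" using K(2)[OF that] \<open>B \<noteq> K\<close> by blast
        then show ?thesis using that(1) K(1) \<open>X = add_None A\<close> by (auto simp: decode_def)
      qed
      show ?thesis
      proof (cases "A = {} \<or> Some ` A \<in> C")
        case True
        then have "?m' A = ?m A" by (auto simp: decode_def \<open>X = add_None A\<close>)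
        then have "?m' = ?m(K \<mapsto> Thick)" using m'K rest by (intro ext) (metis fun_upd_apply)
        then show ?thesis using m KB by (intro resolve_broken) auto
      next
        case False
        have mA: "?m A = None" using False X \<open>X = add_None A\<close> by (auto simp: decode_def)
        have "\<not> (\<exists>B. add_None B \<in> insert X C \<and> B \<subset> A)" using K(2) 1 \<open>X = add_None A\<close> by auto
        then have m'A: "?m' A = Some Broken" using False \<open>X = add_None A\<close> by (auto simp: decode_def)
        have nest: "closely_nested (dom ?m') A K"
        proof -
          have "?m' u = None" if "A \<subset> u" "u \<subset> K" for u
            using that K(2)[of u] D'(6)[of u A] \<open>X = add_None A\<close> by (auto simp: decode_def)
          then have "\<not> (\<exists>u\<in>dom ?m'. A \<subset> u \<and> u \<subset> K)" by (metis domIff)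
          then show ?thesis using m'A m'K 1 by (simp add: closely_nested_def domIff)
        qed
        show ?thesis
        proof (rule split_broken[OF m(1) KB _ _ _ _ _ m(2), where C="{A}"])
          show "?m' = (\<lambda>u. if u \<in> {A} then Some Broken else (?m(K \<mapsto> Thick)) u)"
            using m'A m'K rest by (intro ext) (metis fun_upd_apply singleton_iff)
        qed (use mA nest in auto)
      qed
    next
      case 2
      have A: "Some ` A \<notin> C" "A \<subseteq> V" "V \<noteq> A" "A \<noteq> {}"
        using 2 D'(6)[of A K] D'(2)[of A] flags_add_NoneD(3)[OF C] X K(1) \<open>X = add_None A\<close> by auto
      have VC: "Some ` V \<notin> C" using D'(6)[of V K] K(1) A(2) 2 by auto
      have "\<exists>B. add_None B \<in> C \<and> B \<subset> V" using K(1) 2 A(2) by blast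
      \<comment> \<open>As \<open>K\<close> lies strictly below \<open>V\<close>, the universal tube
        is thick and can host the new thick tube.\<close>
      then have VT: "?m V = Some Thick"
        using V(2) VC flags_add_NoneD(3)[OF C] by (simp add: decode_def)
      have m': "?m' = ?m(A \<mapsto> Thick)"
      proof
        fix B
        \<comment> \<open>Above \<open>A\<close> the pivot \<open>K\<close> is already a witness for
          thickness, so inserting \<open>add_None A\<close> alters no other marking.\<close>
        have "\<exists>B'. add_None B' \<in> C \<and> B' \<subset> B" if "A \<subset> B" using that 2 K(1) by blast
        then have ex: "(\<exists>B'. add_None B' \<in> insert X C \<and> B' \<subset> B) \<longleftrightarrow> (\<exists>B'. add_None B' \<in> C \<and> B' \<subset> B)"
          using \<open>X = add_None A\<close> by auto
        show "?m' B = (?m(A \<mapsto> Thick)) B"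
        proof (cases "B = A")
          case True
          have "\<exists>B'. add_None B' \<in> C \<and> B' \<subset> A" using 2 K(1) by blast
          then show ?thesis using True A(1,4) ex \<open>X = add_None A\<close> by (simp add: decode_def)
        next
          case False
          then show ?thesis unfolding decode_def ex using \<open>X = add_None A\<close> by simp
        qed
      qed
      have "A \<notin> dom ?m" using A X \<open>X = add_None A\<close> by (auto simp: decode_def)
      then show ?thesis using VT A m m' by (intro add_thick[of G ?m V A]) auto
    qed
  qed
qed

text \<open>Every set of sets between \<open>C\<close> and \<open>D\<close> is again a flag, so the
  missing members can be inserted one at a time in any order.\<close>

lemma marking_moves_decode:
  assumes V: "finite V" "V \<noteq> {}" and mt: "\<And>m. marked_tubing G m \<longleftrightarrow> marked_chain V m"
    and "C \<in> flags (add_None V)" "D \<in> flags (add_None V)" "C \<subseteq> D"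
  shows "(marking_move G)\<^sup>*\<^sup>* (decode C) (decode D)"
  using assms(4-)
proof (induction "card (D - C)" arbitrary: C)
  case 0
  have "finite D" using finite_flag[OF 0(3)] V by (simp add: add_None_def)
  then show ?case using 0 by auto
next
  case (Suc k)
  then obtain X where X: "X \<in> D" "X \<notin> C" by (metis Diff_eq_empty_iff card.empty nat.distinct(1) subsetI)
  have D: "insert X C \<in> flags (add_None V)"
    using flags_subset[OF Suc.prems(2), of "insert X C"] Suc.prems(3) X flagsD(3)[OF Suc.prems(1)] by blast
  have "D - insert X C = (D - C) - {X}" by auto
  then have "k = card (D - insert X C)" using Suc.hyps(2) X by simp
  then have "(marking_move G)\<^sup>*\<^sup>* (decode (insert X C)) (decode D)"
    using Suc.hyps(1)[OF _ D Suc.prems(2)] Suc.prems(3) X by simp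
  then show ?case
    using marking_move_decode_insert[OF V mt Suc.prems(1) D X(2)]
    by (blast intro: converse_rtranclp_into_rtranclp)
qed

lemma order_isomorphic_marked_tubings_flags:
  assumes V: "finite V" "V \<noteq> {}" and mt: "\<And>m. marked_tubing G m \<longleftrightarrow> marked_chain V m"
  shows "order_isomorphic {m. marked_tubing G m} (marked_tubing_le G)
    (flags (add_None V)) (\<lambda>C D. D \<subseteq> C)"
  unfolding order_isomorphic_def
proof (intro exI conjI ballI)
  show "bij_betw encode {m. marked_tubing G m} (flags (add_None V))"
    by (rule bij_betwI[of _ _ _ decode])
       (use mt encode_in_flags[OF V] decode_marked_chain[OF V] decode_encode[OF V] encode_decode[OF V] in auto)
  fix m m' assume "m \<in> {m. marked_tubing G m}" "m' \<in> {m. marked_tubing G m}"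
  then have m: "marked_chain V m" "marked_chain V m'" using mt by auto
  show "marked_tubing_le G m m' \<longleftrightarrow> encode m' \<subseteq> encode m"
  proof
    assume "marked_tubing_le G m m'"
    then have "(marking_move G)\<^sup>*\<^sup>* m' m" by (simp add: marked_tubing_le_def)
    then show "encode m' \<subseteq> encode m"
      by (induction rule: rtranclp_induct) (use marking_move_encode[OF V mt] in auto)
  next
    assume "encode m' \<subseteq> encode m"
    then have "(marking_move G)\<^sup>*\<^sup>* (decode (encode m')) (decode (encode m))"
      using marking_moves_decode[OF V mt] encode_in_flags[OF V] m by blast
    then show "marked_tubing_le G m m'"
      using decode_encode[OF V] m by (simp add: marked_tubing_le_def)
  qed
qed

theorem theorem8:
  fixes n :: nat and G :: "('a, 'b) pre_digraph"
  assumes "n \<ge> 2"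
    and "complete_digraph (n - 1) G"
    and "CARD('n::finite) = n"
  shows "(\<forall>P :: 'c::euclidean_space set.
            graph_multiplihedron G P \<longrightarrow>
            combinatorially_equivalent P (permutohedron :: (real ^ 'n) set)) \<and>
         order_isomorphic
           {m. marked_tubing G m} (marked_tubing_le G)
           (nonempty_faces (permutohedron :: (real ^ 'n) set)) (\<subseteq>)"
proof -
  have card: "card (verts G) = n - 1" using assms(2) by (simp add: complete_digraph_def)
  then have V: "finite (verts G)" "verts G \<noteq> {}"
    using assms(1) by (auto intro: card_ge_0_finite)
  \<comment> \<open>The point \<open>None\<close> raises the \<open>n - 1\<close> vertices to
    \<open>n\<close> elements; \<open>n \<ge> 2\<close> keeps the vertex set nonempty.\<close>
  have "card (add_None (verts G)) = card (UNIV :: 'n set)"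
    using V(1) card assms(1,3) by (simp add: add_None_def card_image)
  then obtain h where "bij_betw h (add_None (verts G)) (UNIV :: 'n set)"
    using finite_same_card_bij[of "add_None (verts G)" "UNIV :: 'n set"] V(1) by (auto simp: add_None_def)
  then have iso: "order_isomorphic {m. marked_tubing G m} (marked_tubing_le G)
      (nonempty_faces (permutohedron :: (real ^ 'n) set)) (\<subseteq>)"
    using order_isomorphic_marked_tubings_flags[OF V complete_marked_tubing_iff[OF assms(2) V(2)]]
      order_isomorphic_flags order_isomorphic_flags_faces order_isomorphic_trans by metis
  then show ?thesis
    unfolding graph_multiplihedron_def combinatorially_equivalent_def
    using order_isomorphic_trans by blast
qed

end
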